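(* Let $X$ be a topological space having a countable $cn$-network at a point $x\in X$. Then $X$ has countable tightness at $x$.
   Context: All topological spaces are Hausdorff. A family $\mathcal N$ of subsets of $X$ is a $cn$-network at $x\in X$ if for each neighborhood $O_x$ of $x$ the set $\bigcup\{N\in\mathcal N: x\in N\subset O_x\}$ is a neighborhood of $x$. $X$ has countable tightness at $x$ if whenever $x\in\overline A$ and $A\subseteq X$, then $x\in\overline B$ for some countable $B\subseteq A$. *)

theory Defs
  imports "HOL-Analysis.Analysis"
begin

(* Neighborhoods need not be open: a set U is a neighborhood of x iff some open set
   containing x lies inside U. *)
definition neighborhood_in :: "'a topology \<Rightarrow> 'a \<Rightarrow> 'a set \<Rightarrow> bool" where
  "neighborhood_in X x U \<longleftrightarrow> U \<subseteq> topspace X \<and> x \<in> X interior_of U"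

definition cn_network_at :: "'a topology \<Rightarrow> 'a \<Rightarrow> 'a set set \<Rightarrow> bool" where
  "cn_network_at X x \<N> \<longleftrightarrow>
     (\<forall>N\<in>\<N>. N \<subseteq> topspace X) \<and>
     (\<forall>U. neighborhood_in X x U \<longrightarrow> neighborhood_in X x (\<Union>{N \<in> \<N>. x \<in> N \<and> N \<subseteq> U}))"

definition countable_tightness_at :: "'a topology \<Rightarrow> 'a \<Rightarrow> bool" where
  "countable_tightness_at X x \<longleftrightarrow>
     (\<forall>A. A \<subseteq> topspace X \<and> x \<in> X closure_of A \<longrightarrow>
        (\<exists>B. B \<subseteq> A \<and> countable B \<and> x \<in> X closure_of B))"

end

theory Submission
  imports Defs
begin

text \<open>Given an open \<open>T\<close> around \<open>x\<close>, the network members that contain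
  \<open>x\<close> and lie in \<open>T\<close> cover a neighborhood of \<open>x\<close>. As
  \<open>x\<close> is in the closure of \<open>A\<close>, one of these members meets
  \<open>A\<close>, so its chosen point lies in \<open>T\<close>.\<close>

(* Picking one point of A from every network member that meets A gives the required
   countable subset of A. *)
theorem proposition2p3:
  fixes X :: "'a topology" and x :: 'a
  assumes "Hausdorff_space X"
    and "x \<in> topspace X"
    and "\<exists>\<N>. countable \<N> \<and> cn_network_at X x \<N>"
  shows "countable_tightness_at X x"
  unfolding countable_tightness_at_def
proof (intro allI impI, elim conjE)
  fix A
  assume xA: "x \<in> X closure_of A"
  obtain \<N> where "countable \<N>" and cn: "cn_network_at X x \<N>"
    using assms(3) by blast
  define p where "p N = (SOME a. a \<in> N \<inter> A)" for N
  have p: "p N \<in> N \<inter> A" if "N \<inter> A \<noteq> {}" for N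
    unfolding p_def by (rule someI_ex) (use that in blast)
  \<comment> \<open>\<open>p N\<close> is an unspecified value when \<open>N\<close> misses
    \<open>A\<close>, hence the filter.\<close>
  let ?B = "p ` {N \<in> \<N>. N \<inter> A \<noteq> {}}"
  have "?B \<subseteq> A"
    using p by blast
  moreover have "countable ?B"
    using \<open>countable \<N>\<close> by (intro countable_image countable_Collect)
  moreover have "x \<in> X closure_of ?B"
    unfolding in_closure_of
  proof (intro conjI allI impI)
    show "x \<in> topspace X"
      by (rule assms(2))
  next
    fix T
    assume T: "x \<in> T \<and> openin X T"
    then have "neighborhood_in X x T"
      by (simp add: neighborhood_in_def interior_of_openin openin_subset)
    then have "x \<in> X interior_of \<Union>{N \<in> \<N>. x \<in> N \<and> N \<subseteq> T}"
      using cn by (simp add: cn_network_at_def neighborhood_in_def)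
    \<comment> \<open>The union need not be open, so the closure hypothesis is applied to its
      interior.\<close>
    then obtain a where "a \<in> A" "a \<in> X interior_of \<Union>{N \<in> \<N>. x \<in> N \<and> N \<subseteq> T}"
      using xA openin_interior_of unfolding in_closure_of by metis
    then obtain N where "N \<in> \<N>" "N \<subseteq> T" "a \<in> N"
      using interior_of_subset by fastforce
    \<comment> \<open>\<open>a\<close> only shows that \<open>N\<close> meets \<open>A\<close>; the
      witness is \<open>p N\<close>, which is in \<open>T\<close> since
      \<open>N \<subseteq> T\<close>.\<close>
    with \<open>a \<in> A\<close> p[of N] show "\<exists>y. y \<in> ?B \<and> y \<in> T"
      by blast
  qed
  ultimately show "\<exists>B\<subseteq>A. countable B \<and> x \<in> X closure_of B"
    by blast
qed

end
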